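(* Let $G(p)$ be a continuous tensegrity in $\mathbb{R}^n$ with (compact) edgeset $\mathscr{E}$, rigidity operator $Y$ and space of design variations $\mathcal{X}$. Then $G(p)$ is partially $\mathcal{X}$-bar equivalent if and only if $G(p)$ has a semipositive stress.
   Context: A (continuous) tensegrity $G(p)$ in $\mathbb{R}^n$ consists of a (possibly infinite) set $\mathscr{V}$ of vertices, an injective map $p:\mathscr{V}\to\mathbb{R}^n$, and three pairwise disjoint sets $\mathsf{S}$ (struts), $\mathsf{C}$ (cables), $\mathsf{B}$ (bars) of two-element subsets of $\mathscr{V}$. The set $\mathscr{V}$ carries the metric $d_{\mathscr V}(v,w)=\|p(v)-p(w)\|$. Put $\mathscr{S}=\mathsf{S}\cup\mathsf{B}$ and $\mathscr{C}=\mathsf{C}\cup\mathsf{B}$ (functional struts and cables). The edgeset is the disjoint union $\mathscr{E}=\mathscr{S}\sqcup\mathscr{C}$ (so a bar occurs twice, once as a strut and once as a cable). Two edges of the same type have distance $\min\{\max(d_{\mathscr V}(v_1,v_3),d_{\mathscr V}(v_2,v_4)),\max(d_{\mathscr V}(v_1,v_4),d_{\mathscr V}(v_2,v_3))\}$ for edges $\{v_1,v_2\},\{v_3,v_4\}$; edges of different types have distance $\infty$. $\mathscr{E}$ has the metric topology and is required to be compact. $\mathrm{Vf}(\mathscr{V})$ is the space of continuous maps $V:\mathscr{V}\to\mathbb{R}^n$ (variations). $T(p)$ is the set of Euclidean motions, i.e. variations $v\mapsto Mp(v)+t$ with $M$ a skew-symmetric $n\times n$ matrix and $t\in\mathbb{R}^n$.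 The design variations form a linear subspace $\mathcal{X}\subset\mathrm{Vf}(\mathscr{V})$ with $T(p)\subset\mathcal{X}$. The rigidity operator $Y:\mathrm{Vf}(\mathscr{V})\to C(\mathscr{E})$ is $(YV)(\{v_1,v_2\})=\pm(V(v_1)-V(v_2))\cdot(p(v_1)-p(v_2))$, with sign $+$ on $\mathscr{S}$ and $-$ on $\mathscr{C}$. $Y(\mathcal{X})=\{YV:V\in\mathcal{X}\}$. $C(\mathscr{E})$ is the space of continuous real functions on $\mathscr{E}$ with the sup norm, $C(\mathscr{E})^+$ the set of nonnegative ones, and $C^*(\mathscr{E})$ the topological dual of $C(\mathscr{E})$. A strictly positive motion is a $V\in\mathcal{X}$ with $YV(e)>0$ for all $e\in\mathscr{E}$. $G(p)$ is partially $\mathcal{X}$-bar equivalent if it has no strictly positive motion. A stress is a $\mu\in C^*(\mathscr{E})$ with $\mu(YV)=0$ for all $V\in\mathcal{X}$; a semipositive stress is a nonzero stress $\mu$ with $\mu(f)\ge 0$ for all $f\in C(\mathscr{E})^+$. *)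

theory Defs
  imports "HOL-Analysis.Analysis"
begin

locale tensegrity =
  fixes Vs :: "'v set"
    and p :: "'v \<Rightarrow> real ^ 'n"
    and struts cables bars :: "'v set set"
  assumes inj_p: "inj_on p Vs"
    and struts_edges: "\<And>e. e \<in> struts \<Longrightarrow> e \<subseteq> Vs \<and> card e = 2"
    and cables_edges: "\<And>e. e \<in> cables \<Longrightarrow> e \<subseteq> Vs \<and> card e = 2"
    and bars_edges: "\<And>e. e \<in> bars \<Longrightarrow> e \<subseteq> Vs \<and> card e = 2"
    and disjoint_types:
      "struts \<inter> cables = {}" "struts \<inter> bars = {}" "cables \<inter> bars = {}"
begin

definition vdist :: "'v \<Rightarrow> 'v \<Rightarrow> real" where
  "vdist v w = norm (p v - p w)"

sublocale vertices: Metric_space Vs vdist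
proof
  show "vdist x z \<le> vdist x y + vdist y z" for x y z
    unfolding vdist_def by (metis dist_norm dist_triangle)
qed (use inj_p in \<open>auto simp: vdist_def norm_minus_commute inj_on_def\<close>)

text \<open>The left summand consists of the functional struts and the right summand
  of the functional cables, so every bar gives rise to two edges.\<close>

definition edges :: "('v set + 'v set) set" where
  "edges = (struts \<union> bars) <+> (cables \<union> bars)"

text \<open>The minimum ranges over all ways of labelling the end points of both edges;
  up to symmetry there are two of them.\<close>

definition pair_dist :: "'v set \<Rightarrow> 'v set \<Rightarrow> real" where
  "pair_dist e f =
     Min {max (vdist v1 v3) (vdist v2 v4) | v1 v2 v3 v4. e = {v1, v2} \<and> f = {v3, v4}}"

lemma pair_dist_doubleton:
  "pair_dist {v1, v2} {v3, v4} =
     min (max (vdist v1 v3) (vdist v2 v4)) (max (vdist v1 v4) (vdist v2 v3))"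
proof -
  have "{max (vdist w1 w3) (vdist w2 w4) | w1 w2 w3 w4.
            {v1, v2} = {w1, w2} \<and> {v3, v4} = {w3, w4}} =
        {max (vdist v1 v3) (vdist v2 v4), max (vdist v1 v4) (vdist v2 v3)}"
    unfolding doubleton_eq_iff by (auto simp: max.commute)
  then show ?thesis
    unfolding pair_dist_def by simp
qed

definition edge_dist :: "'v set + 'v set \<Rightarrow> 'v set + 'v set \<Rightarrow> ereal" where
  "edge_dist a b = (case (a, b) of
       (Inl e, Inl f) \<Rightarrow> ereal (pair_dist e f)
     | (Inr e, Inr f) \<Rightarrow> ereal (pair_dist e f)
     | _ \<Rightarrow> \<infinity>)"

definition edge_topology :: "('v set + 'v set) topology" where
  "edge_topology = topology (\<lambda>U. U \<subseteq> edges \<and>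
     (\<forall>a\<in>U. \<exists>r>0. \<forall>b\<in>edges. edge_dist a b < ereal r \<longrightarrow> b \<in> U))"

lemma openin_edge_topology:
  "openin edge_topology U \<longleftrightarrow>
     U \<subseteq> edges \<and> (\<forall>a\<in>U. \<exists>r>0. \<forall>b\<in>edges. edge_dist a b < ereal r \<longrightarrow> b \<in> U)"
proof -
  let ?P = "\<lambda>U. U \<subseteq> edges \<and>
    (\<forall>a\<in>U. \<exists>r>0. \<forall>b\<in>edges. edge_dist a b < ereal r \<longrightarrow> b \<in> U)"
  have "istopology ?P"
    unfolding istopology_def
  proof (intro conjI allI impI)
    fix S T assume S: "?P S" and T: "?P T"
    show "S \<inter> T \<subseteq> edges" using S by blast
    show "\<forall>a\<in>S \<inter> T. \<exists>r>0. \<forall>b\<in>edges. edge_dist a b < ereal r \<longrightarrow> b \<in> S \<inter> T"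
    proof
      fix a assume a: "a \<in> S \<inter> T"
      obtain r where r: "r > 0" "\<And>b. b \<in> edges \<Longrightarrow> edge_dist a b < ereal r \<Longrightarrow> b \<in> S"
        using S a by blast
      obtain s where s: "s > 0" "\<And>b. b \<in> edges \<Longrightarrow> edge_dist a b < ereal s \<Longrightarrow> b \<in> T"
        using T a by blast
      have "edge_dist a b < ereal r \<and> edge_dist a b < ereal s"
        if "edge_dist a b < ereal (min r s)" for b
        using less_le_trans[OF that, of "ereal r"] less_le_trans[OF that, of "ereal s"] by simp
      then show "\<exists>r>0. \<forall>b\<in>edges. edge_dist a b < ereal r \<longrightarrow> b \<in> S \<inter> T"
        using r s by (intro exI[of _ "min r s"]) auto
    qed
  next
    fix K assume K: "\<forall>U\<in>K. ?P U"
    then show "\<Union>K \<subseteq> edges" by blast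
    show "\<forall>a\<in>\<Union>K. \<exists>r>0. \<forall>b\<in>edges. edge_dist a b < ereal r \<longrightarrow> b \<in> \<Union>K"
      using K by (meson UnionE UnionI)
  qed
  then show ?thesis
    unfolding edge_topology_def by simp
qed

lemma topspace_edge_topology [simp]: "topspace edge_topology = edges"
proof
  show "topspace edge_topology \<subseteq> edges"
    using openin_topspace[of edge_topology] unfolding openin_edge_topology by blast
  have "openin edge_topology edges"
    unfolding openin_edge_topology by (auto intro: exI[of _ 1])
  then show "edges \<subseteq> topspace edge_topology"
    by (rule openin_subset)
qed

text \<open>Maps on \<open>Vs\<close> and on the edgeset are represented by extensional functions, so that
  two of them are equal as soon as they agree on their domain. The pointwise vector space
  operations have to be restricted accordingly.\<close>

definition variations :: "('v \<Rightarrow> real ^ 'n) set" where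
  "variations = {V \<in> extensional Vs. continuous_map vertices.mtopology euclidean V}"

definition euclidean_motions :: "('v \<Rightarrow> real ^ 'n) set" where
  "euclidean_motions =
     {(\<lambda>v\<in>Vs. M *v p v + t) | M t. transpose M = - M}"

definition linear_subspace_of_variations :: "('v \<Rightarrow> real ^ 'n) set \<Rightarrow> bool" where
  "linear_subspace_of_variations X \<longleftrightarrow>
     X \<subseteq> variations \<and>
     (\<lambda>v\<in>Vs. 0) \<in> X \<and>
     (\<forall>V\<in>X. \<forall>W\<in>X. (\<lambda>v\<in>Vs. V v + W v) \<in> X) \<and>
     (\<forall>c. \<forall>V\<in>X. (\<lambda>v\<in>Vs. c *\<^sub>R V v) \<in> X)"

definition length_change :: "('v \<Rightarrow> real ^ 'n) \<Rightarrow> 'v set \<Rightarrow> real" where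
  "length_change V e =
     (THE r. \<exists>v1 v2. e = {v1, v2} \<and> r = (V v1 - V v2) \<bullet> (p v1 - p v2))"

lemma length_change_doubleton:
  "length_change V {v1, v2} = (V v1 - V v2) \<bullet> (p v1 - p v2)"
  unfolding length_change_def
proof (rule the_equality)
  fix r assume "\<exists>w1 w2. {v1, v2} = {w1, w2} \<and> r = (V w1 - V w2) \<bullet> (p w1 - p w2)"
  then show "r = (V v1 - V v2) \<bullet> (p v1 - p v2)"
    unfolding doubleton_eq_iff by (auto simp: inner_diff_left inner_diff_right)
qed blast

definition rigidity_operator :: "('v \<Rightarrow> real ^ 'n) \<Rightarrow> ('v set + 'v set \<Rightarrow> real)" where
  "rigidity_operator V =
     (\<lambda>a\<in>edges. case a of Inl e \<Rightarrow> length_change V e | Inr e \<Rightarrow> - length_change V e)"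

definition edge_functions :: "('v set + 'v set \<Rightarrow> real) set" where
  "edge_functions = {f \<in> extensional edges. continuous_map edge_topology euclideanreal f}"

lemma rigidity_operator_in_edge_functions:
  assumes "V \<in> variations"
  shows "rigidity_operator V \<in> edge_functions"
proof -
  let ?M = "vertices.mtopology"
  define g where "g = (\<lambda>(w1, w2). (V w1 - V w2) \<bullet> (p w1 - p w2))"
  have V: "continuous_map ?M euclidean V"
    using assms by (simp add: variations_def)
  have "continuous_map ?M (mtopology_of euclidean_metric) p"
    unfolding mtopology_of_def
    by (subst vertices.metric_continuous_map)
      (auto simp: Met_TC.Metric_space_axioms vdist_def dist_norm)
  then have p: "continuous_map ?M euclidean p"
    by simp
  have fst: "continuous_map (prod_topology ?M ?M) ?M fst"
    and snd: "continuous_map (prod_topology ?M ?M) ?M snd"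
    by (simp_all add: continuous_map_fst continuous_map_snd)
  have "continuous_map (prod_topology ?M ?M)
      (prod_topology (prod_topology euclidean euclidean) (prod_topology euclidean euclidean))
      (\<lambda>w. (((V \<circ> fst) w, (V \<circ> snd) w), ((p \<circ> fst) w, (p \<circ> snd) w)))"
    by (intro continuous_map_pairedI continuous_map_compose[OF fst] continuous_map_compose[OF snd] V p)
  moreover have "continuous_map euclidean euclideanreal
      (\<lambda>x :: ((real^'n) \<times> (real^'n)) \<times> ((real^'n) \<times> (real^'n)).
         (fst (fst x) - snd (fst x)) \<bullet> (fst (snd x) - snd (snd x)))"
    by (simp, intro continuous_intros)
  ultimately have "continuous_map (prod_topology ?M ?M) euclideanreal
      ((\<lambda>x. (fst (fst x) - snd (fst x)) \<bullet> (fst (snd x) - snd (snd x))) \<circ>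
       (\<lambda>w. (((V \<circ> fst) w, (V \<circ> snd) w), ((p \<circ> fst) w, (p \<circ> snd) w))))"
    by (simp add: continuous_map_compose)
  then have g: "continuous_map (prod_topology ?M ?M) euclideanreal g"
    by (simp add: g_def o_def case_prod_unfold)
  have near: "\<exists>r>0. \<forall>f. f \<subseteq> Vs \<and> card f = 2 \<and> pair_dist e f < r \<longrightarrow> length_change V f \<in> U"
    if e: "e \<subseteq> Vs" "card e = 2" and U: "open U" "length_change V e \<in> U" for e U
  proof -
    obtain v1 v2 where v: "e = {v1, v2}"
      using e by (meson card_2_iff)
    let ?W = "{w \<in> topspace (prod_topology ?M ?M). g w \<in> U}"
    have "openin (prod_topology ?M ?M) ?W"
      using g U by (simp add: continuous_map)
    moreover have "(v1, v2) \<in> ?W"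
      using e U v by (auto simp: g_def length_change_doubleton)
    ultimately obtain A B where AB: "openin ?M A" "openin ?M B" "v1 \<in> A" "v2 \<in> B" "A \<times> B \<subseteq> ?W"
      unfolding openin_prod_topology_alt by meson
    then obtain r s where r: "r > 0" "vertices.mball v1 r \<subseteq> A"
      and s: "s > 0" "vertices.mball v2 s \<subseteq> B"
      by (meson vertices.openin_mtopology)
    have in_U: "length_change V {w1, w2} \<in> U"
      if "w1 \<in> Vs" "w2 \<in> Vs" "vdist v1 w1 < r" "vdist v2 w2 < s" for w1 w2
    proof -
      have "(w1, w2) \<in> A \<times> B"
        using that e v r s by (auto simp: vertices.in_mball subset_iff)
      then show ?thesis
        using AB by (auto simp: g_def length_change_doubleton)
    qed
    have "length_change V f \<in> U" if f: "f \<subseteq> Vs" "card f = 2" "pair_dist e f < min r s" for f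
    proof -
      obtain w1 w2 where w: "f = {w1, w2}"
        using f by (meson card_2_iff)
      have "vdist v1 w1 < r \<and> vdist v2 w2 < s \<or> vdist v1 w2 < r \<and> vdist v2 w1 < s"
        using f unfolding v w pair_dist_doubleton by (auto simp: min_less_iff_disj)
      then show ?thesis
        using in_U[of w1 w2] in_U[of w2 w1] f w by (metis insert_commute insert_subset)
    qed
    then show ?thesis
      using r s by (intro exI[of _ "min r s"]) auto
  qed
  have sub: "e \<subseteq> Vs \<and> card e = 2" if "Inl e \<in> edges \<or> Inr e \<in> edges" for e
    using that struts_edges cables_edges bars_edges by (auto simp: edges_def)
  have "openin edge_topology {a \<in> edges. rigidity_operator V a \<in> U}" if U: "open U" for U
    unfolding openin_edge_topology
  proof (intro conjI ballI)
    fix a assume "a \<in> {a \<in> edges. rigidity_operator V a \<in> U}"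
    then have a: "a \<in> edges" "rigidity_operator V a \<in> U"
      by auto
    show "\<exists>r>0. \<forall>b\<in>edges. edge_dist a b < ereal r \<longrightarrow>
        b \<in> {a \<in> edges. rigidity_operator V a \<in> U}"
    proof (cases a)
      case (Inl e)
      then obtain r where r: "r > 0"
          "\<And>f. f \<subseteq> Vs \<Longrightarrow> card f = 2 \<Longrightarrow> pair_dist e f < r \<Longrightarrow> length_change V f \<in> U"
        using near[OF _ _ U, of e] a sub[of e] by (auto simp: rigidity_operator_def)
      have "b \<in> {a \<in> edges. rigidity_operator V a \<in> U}"
        if "b \<in> edges" "edge_dist a b < ereal r" for b
        using that Inl r(2) sub
        by (cases b) (auto simp: edge_dist_def rigidity_operator_def)
      with r(1) show ?thesis by blast
    next
      case (Inr e)
      have "open (uminus ` U)"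
        using U by (rule open_negations)
      moreover have "length_change V e \<in> uminus ` U"
        using a Inr by (force simp: rigidity_operator_def)
      ultimately obtain r where r: "r > 0"
          "\<And>f. f \<subseteq> Vs \<Longrightarrow> card f = 2 \<Longrightarrow> pair_dist e f < r \<Longrightarrow> - length_change V f \<in> U"
        using near[of e "uminus ` U"] a Inr sub[of e] by (smt (verit) image_iff minus_minus)
      have "b \<in> {a \<in> edges. rigidity_operator V a \<in> U}"
        if "b \<in> edges" "edge_dist a b < ereal r" for b
        using that Inr r(2) sub
        by (cases b) (auto simp: edge_dist_def rigidity_operator_def)
      with r(1) show ?thesis by blast
    qed
  qed auto
  then show ?thesis
    by (auto simp: edge_functions_def continuous_map rigidity_operator_def)
qed

definition nonneg_edge_functions :: "('v set + 'v set \<Rightarrow> real) set" where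
  "nonneg_edge_functions = {f \<in> edge_functions. \<forall>a\<in>edges. 0 \<le> f a}"

text \<open>The metric of \<open>cfunspace\<close> is the supremum metric. Its carrier is \<open>edge_functions\<close> if
  the edgeset is compact, see \<open>mspace_cfunspace_edge_topology\<close> below.\<close>

definition edge_dual :: "(('v set + 'v set \<Rightarrow> real) \<Rightarrow> real) set" where
  "edge_dual =
     {\<mu> \<in> extensional edge_functions.
        (\<forall>f\<in>edge_functions. \<forall>g\<in>edge_functions. \<mu> (\<lambda>a\<in>edges. f a + g a) = \<mu> f + \<mu> g) \<and>
        (\<forall>c. \<forall>f\<in>edge_functions. \<mu> (\<lambda>a\<in>edges. c * f a) = c * \<mu> f) \<and>
        continuous_map (mtopology_of (cfunspace edge_topology euclidean_metric)) euclideanreal \<mu>}"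

end

locale continuous_tensegrity = tensegrity Vs p struts cables bars
  for Vs :: "'v set" and p :: "'v \<Rightarrow> real ^ 'n" and struts cables bars +
  fixes X :: "('v \<Rightarrow> real ^ 'n) set"
  assumes compact_edges: "compact_space edge_topology"
    and subspace_X: "linear_subspace_of_variations X"
    and motions_X: "euclidean_motions \<subseteq> X"
begin

lemma mspace_cfunspace_edge_topology:
  "mspace (cfunspace edge_topology (euclidean_metric :: real metric)) = edge_functions"
proof -
  have "Metric_space.mbounded UNIV dist (f ` edges)"
    if "continuous_map edge_topology euclideanreal f" for f
    using image_compactin[OF _ that, of edges] compact_edges
    by (simp add: compact_space_def compact_imp_bounded)
  then show ?thesis
    by (auto simp: edge_functions_def)
qed

definition strictly_positive_motion :: "('v \<Rightarrow> real ^ 'n) \<Rightarrow> bool" where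
  "strictly_positive_motion V \<longleftrightarrow> V \<in> X \<and> (\<forall>a\<in>edges. rigidity_operator V a > 0)"

definition partially_bar_equivalent :: bool where
  "partially_bar_equivalent \<longleftrightarrow> (\<nexists>V. strictly_positive_motion V)"

definition stress :: "(('v set + 'v set \<Rightarrow> real) \<Rightarrow> real) \<Rightarrow> bool" where
  "stress \<mu> \<longleftrightarrow> \<mu> \<in> edge_dual \<and> (\<forall>V\<in>X. \<mu> (rigidity_operator V) = 0)"

definition semipositive_stress :: "(('v set + 'v set \<Rightarrow> real) \<Rightarrow> real) \<Rightarrow> bool" where
  "semipositive_stress \<mu> \<longleftrightarrow>
     stress \<mu> \<and> (\<exists>f\<in>edge_functions. \<mu> f \<noteq> 0) \<and> (\<forall>f\<in>nonneg_edge_functions. 0 \<le> \<mu> f)"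

end

end

theory Submission
  imports Defs
begin

text \<open>
  If \<open>\<mu>\<close> is a semipositive stress and \<open>V\<close> a strictly positive motion, then \<open>Y V\<close> is bounded below
  by a positive constant, so every continuous \<open>f\<close> lies between two multiples of \<open>Y V\<close>, which
  forces \<open>\<mu> f = 0\<close>.

  Conversely, let \<open>G = Y(\<X>)\<close>. If no element of \<open>G\<close> is strictly positive, then
  \<open>Q f = inf {sup (f + g) | g \<in> G}\<close> is a finite sublinear functional on \<open>C(\<E>)\<close> with \<open>Q g \<le> 0\<close> on
  \<open>G\<close>, \<open>Q f \<le> sup f\<close> and \<open>Q (-1) \<le> -1\<close>. Any linear functional below \<open>Q\<close> is a semipositive stress.
  One exists because a minimal sublinear functional below \<open>Q\<close>, provided by Zorn's lemma, is
  linear: if \<open>P\<close> is minimal, then \<open>f \<mapsto> inf {P (f + t h) - t P h | t \<ge> 0}\<close> is sublinear and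
  below \<open>P\<close>, hence equal to \<open>P\<close>, and \<open>t = 1\<close> gives \<open>P f + P h \<le> P (f + h)\<close>.
\<close>

section \<open>Linear functionals below a sublinear one\<close>

text \<open>Functions are total here, so the pointwise operations need no restriction to a domain.
  Nonemptiness yields the zero function by scaling with 0.\<close>

definition function_subspace :: "('a \<Rightarrow> real) set \<Rightarrow> bool" where
  "function_subspace F \<longleftrightarrow> F \<noteq> {} \<and>
     (\<forall>f\<in>F. \<forall>g\<in>F. (\<lambda>x. f x + g x) \<in> F) \<and> (\<forall>c. \<forall>f\<in>F. (\<lambda>x. c * f x) \<in> F)"

lemma function_subspaceD:
  assumes "function_subspace F"
  shows function_subspace_add: "\<And>f g. f \<in> F \<Longrightarrow> g \<in> F \<Longrightarrow> (\<lambda>x. f x + g x) \<in> F"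
    and function_subspace_scale: "\<And>c f. f \<in> F \<Longrightarrow> (\<lambda>x. c * f x) \<in> F"
    and function_subspace_minus: "\<And>f. f \<in> F \<Longrightarrow> (\<lambda>x. - f x) \<in> F"
    and function_subspace_zero: "(\<lambda>x. 0) \<in> F"
proof -
  show scale: "(\<lambda>x. c * f x) \<in> F" if "f \<in> F" for c f
    using assms that by (auto simp: function_subspace_def)
  show "(\<lambda>x. - f x) \<in> F" if "f \<in> F" for f
    using scale[OF that, of "-1"] by simp
  obtain f where "f \<in> F"
    using assms by (auto simp: function_subspace_def)
  then show "(\<lambda>x. 0) \<in> F"
    using scale[of f 0] by simp
qed (use assms in \<open>auto simp: function_subspace_def\<close>)

text \<open>Only inequalities are demanded, and only for \<open>c > 0\<close>, since this is the
  form that passes directly to infima. Positive homogeneity and the value 0 at the zero function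
  follow from it.\<close>

definition sublinear_on :: "('a \<Rightarrow> real) set \<Rightarrow> (('a \<Rightarrow> real) \<Rightarrow> real) \<Rightarrow> bool" where
  "sublinear_on F P \<longleftrightarrow>
     (\<forall>f\<in>F. \<forall>g\<in>F. P (\<lambda>x. f x + g x) \<le> P f + P g) \<and>
     (\<forall>c>0. \<forall>f\<in>F. P (\<lambda>x. c * f x) \<le> c * P f)"

definition linear_functional_on :: "('a \<Rightarrow> real) set \<Rightarrow> (('a \<Rightarrow> real) \<Rightarrow> real) \<Rightarrow> bool" where
  "linear_functional_on F m \<longleftrightarrow>
     (\<forall>f\<in>F. \<forall>g\<in>F. m (\<lambda>x. f x + g x) = m f + m g) \<and>
     (\<forall>c. \<forall>f\<in>F. m (\<lambda>x. c * f x) = c * m f)"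

context
  fixes F :: "('a \<Rightarrow> real) set"
  assumes F: "function_subspace F"
begin

lemma sublinear_on_add:
  "sublinear_on F P \<Longrightarrow> f \<in> F \<Longrightarrow> g \<in> F \<Longrightarrow> P (\<lambda>x. f x + g x) \<le> P f + P g"
  by (simp add: sublinear_on_def)

text \<open>The reverse inequality is the defining one for the factor \<open>inverse c\<close>,
  applied to the function \<open>c * f\<close>.\<close>

lemma sublinear_on_scale:
  assumes "sublinear_on F P" "f \<in> F" "c > 0"
  shows "P (\<lambda>x. c * f x) = c * P f"
proof (rule antisym)
  show "P (\<lambda>x. c * f x) \<le> c * P f"
    using assms by (simp add: sublinear_on_def)
  have "P (\<lambda>x. inverse c * (c * f x)) \<le> inverse c * P (\<lambda>x. c * f x)"
    using assms function_subspace_scale[OF F] by (simp add: sublinear_on_def)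
  moreover have "inverse c * (c * f x) = f x" for x
    using assms by simp
  ultimately show "c * P f \<le> P (\<lambda>x. c * f x)"
    using assms by (simp add: field_simps)
qed

lemma sublinear_on_zero:
  assumes "sublinear_on F P"
  shows "P (\<lambda>x. 0) = 0"
  using sublinear_on_scale[OF assms function_subspace_zero[OF F], of 2] by simp

lemma sublinear_on_minus:
  assumes "sublinear_on F P" "f \<in> F"
  shows "- P (\<lambda>x. - f x) \<le> P f"
  using sublinear_on_add[OF assms function_subspace_minus[OF F assms(2)]] sublinear_on_zero[OF assms(1)]
  by simp

text \<open>The index \<open>k\<close> may depend on everything before it, which covers three uses:
  the smaller of two members of a chain, the sum of two parameters \<open>t \<ge> 0\<close>, and the
  sum of two elements of a subspace \<open>G\<close>.\<close>

lemma sublinear_on_INF: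
  assumes "I \<noteq> {}"
    and bdd: "\<And>f. f \<in> F \<Longrightarrow> bdd_below ((\<lambda>i. P i f) ` I)"
    and add: "\<And>i j f g. i \<in> I \<Longrightarrow> j \<in> I \<Longrightarrow> f \<in> F \<Longrightarrow> g \<in> F \<Longrightarrow>
      \<exists>k\<in>I. P k (\<lambda>x. f x + g x) \<le> P i f + P j g"
    and scale: "\<And>i c f. i \<in> I \<Longrightarrow> c > 0 \<Longrightarrow> f \<in> F \<Longrightarrow> \<exists>k\<in>I. P k (\<lambda>x. c * f x) \<le> c * P i f"
  shows "sublinear_on F (\<lambda>f. INF i\<in>I. P i f)"
  unfolding sublinear_on_def
proof (intro conjI ballI allI impI)
  fix f g assume f: "f \<in> F" and g: "g \<in> F"
  let ?R = "INF i\<in>I. P i (\<lambda>x. f x + g x)"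
  have *: "?R \<le> P i f + P j g" if "i \<in> I" "j \<in> I" for i j
    using add[OF that f g] bdd[OF function_subspace_add[OF F f g]] by (meson cINF_lower2)
  \<comment> \<open>The two indices vary independently, so the infimum is taken over
    \<open>j\<close> with \<open>i\<close> fixed, and over \<open>i\<close> afterwards.\<close>
  have "?R - P i f \<le> (INF j\<in>I. P j g)" if "i \<in> I" for i
    using *[OF that] by (intro cINF_greatest \<open>I \<noteq> {}\<close>) (simp add: algebra_simps)
  then have "?R - (INF j\<in>I. P j g) \<le> (INF i\<in>I. P i f)"
    by (intro cINF_greatest \<open>I \<noteq> {}\<close>) (simp add: algebra_simps)
  then show "?R \<le> (INF i\<in>I. P i f) + (INF j\<in>I. P j g)"
    by simp
next
  fix c :: real and f assume c: "c > 0" and f: "f \<in> F"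
  let ?R = "INF i\<in>I. P i (\<lambda>x. c * f x)"
  have "?R \<le> c * P i f" if "i \<in> I" for i
    using scale[OF that c f] bdd[OF function_subspace_scale[OF F f]] by (meson cINF_lower2)
  then have "?R / c \<le> (INF i\<in>I. P i f)"
    using c by (intro cINF_greatest \<open>I \<noteq> {}\<close>) (simp add: field_simps)
  then show "?R \<le> c * (INF i\<in>I. P i f)"
    using c by (simp add: field_simps)
qed

text \<open>Zorn's lemma for the reversed pointwise order. The infimum of a nonempty chain is finite
  because all functionals below \<open>Q\<close> share the lower bound \<open>- Q (- f)\<close> at
  \<open>f\<close>.\<close>

lemma minimal_sublinear_on_exists:
  assumes Q: "sublinear_on F Q"
  obtains P where "sublinear_on F P" "\<And>f. f \<in> F \<Longrightarrow> P f \<le> Q f"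
    "\<forall>R. sublinear_on F R \<and> (\<forall>f\<in>F. R f \<le> P f) \<longrightarrow> (\<forall>f\<in>F. R f = P f)"
proof -
  \<comment> \<open>Extensionality makes the pointwise order on \<open>F\<close>
    antisymmetric.\<close>
  define \<A> where "\<A> = {P \<in> extensional F. sublinear_on F P \<and> (\<forall>f\<in>F. P f \<le> Q f)}"
  \<comment> \<open>\<open>?le P R\<close> puts \<open>R\<close> below \<open>P\<close>, so a
    maximal element for \<open>?le\<close> is pointwise minimal.\<close>
  let ?le = "\<lambda>P R. \<forall>f\<in>F. R f \<le> (P f :: real)"
  have restrict: "sublinear_on F (restrict R F) \<longleftrightarrow> sublinear_on F R" for R
    using function_subspaceD[OF F] by (simp add: sublinear_on_def)
  have lower: "- Q (\<lambda>x. - f x) \<le> P f" if "P \<in> \<A>" "f \<in> F" for P f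
    using that sublinear_on_minus[of P f] function_subspace_minus[OF F that(2)]
    by (fastforce simp: \<A>_def)
  have "\<exists>P\<in>\<A>. \<forall>R\<in>\<A>. ?le P R \<longrightarrow> R = P"
  proof (rule predicate_Zorn)
    show "partial_order_on \<A> (relation_of ?le \<A>)"
    proof (rule partial_order_on_relation_ofI)
      show "\<And>P R S. P \<in> \<A> \<Longrightarrow> R \<in> \<A> \<Longrightarrow> S \<in> \<A> \<Longrightarrow> ?le P R \<Longrightarrow> ?le R S \<Longrightarrow> ?le P S"
        by (meson order_trans)
      show "\<And>P R. P \<in> \<A> \<Longrightarrow> R \<in> \<A> \<Longrightarrow> ?le P R \<Longrightarrow> ?le R P \<Longrightarrow> P = R"
        by (rule extensionalityI[of _ F]) (auto simp: \<A>_def intro: antisym)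
    qed auto
    show "\<exists>U\<in>\<A>. \<forall>P\<in>C. ?le P U" if C: "C \<in> Chains (relation_of ?le \<A>)" for C
    proof (cases "C = {}")
      case True
      have "restrict Q F \<in> \<A>"
        using Q by (auto simp: \<A>_def restrict)
      with True show ?thesis by blast
    next
      case False
      have CA: "C \<subseteq> \<A>"
        using Chains_relation_of[OF C] .
      have total: "?le P R \<or> ?le R P" if "P \<in> C" "R \<in> C" for P R
        using C that unfolding Chains_def relation_of_def by blast
      have bdd: "bdd_below ((\<lambda>P. P f) ` C)" if "f \<in> F" for f
        using lower[OF _ that] CA by (intro bdd_belowI[of _ "- Q (\<lambda>x. - f x)"]) auto
      have sub: "sublinear_on F (\<lambda>f. INF P\<in>C. P f)"
      proof (rule sublinear_on_INF[OF False bdd])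
        fix P R f g assume PR: "P \<in> C" "R \<in> C" and fg: "f \<in> F" "g \<in> F"
        have "sublinear_on F P" "sublinear_on F R"
          using PR CA by (auto simp: \<A>_def)
        then have "P (\<lambda>x. f x + g x) \<le> P f + P g" "R (\<lambda>x. f x + g x) \<le> R f + R g"
          using fg by (auto intro: sublinear_on_add)
        \<comment> \<open>One of \<open>P\<close> and \<open>R\<close> lies below the other on all
          of \<open>F\<close>; the smaller one serves as \<open>S\<close>.\<close>
        then show "\<exists>S\<in>C. S (\<lambda>x. f x + g x) \<le> P f + R g"
          using total[OF PR] PR fg by (smt (verit))
      next
        fix P c f assume "P \<in> C" "(c::real) > 0" "f \<in> F"
        then show "\<exists>S\<in>C. S (\<lambda>x. c * f x) \<le> c * P f"
          using CA by (force simp: \<A>_def sublinear_on_def)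
      qed
      let ?U = "restrict (\<lambda>f. INF P\<in>C. P f) F"
      have le: "?U f \<le> P f" if "P \<in> C" "f \<in> F" for P f
        using that bdd[OF that(2)] by (auto intro: cINF_lower)
      obtain P where "P \<in> C" using False by blast
      then have "?U f \<le> Q f" if "f \<in> F" for f
        using le[OF _ that, of P] CA that by (force simp: \<A>_def)
      then have "?U \<in> \<A>"
        using sub restrict by (auto simp: \<A>_def)
      with le show ?thesis by blast
    qed
  qed
  then obtain P where P: "P \<in> \<A>" and min: "\<And>R. R \<in> \<A> \<Longrightarrow> ?le P R \<Longrightarrow> R = P"
    by blast
  show thesis
  proof
    show "sublinear_on F P" "\<And>f. f \<in> F \<Longrightarrow> P f \<le> Q f"
      using P by (auto simp: \<A>_def)
    show "\<forall>R. sublinear_on F R \<and> (\<forall>f\<in>F. R f \<le> P f) \<longrightarrow> (\<forall>f\<in>F. R f = P f)"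
    proof (intro allI impI ballI, elim conjE)
      fix R f assume R: "sublinear_on F R" "\<forall>g\<in>F. R g \<le> P g" and f: "f \<in> F"
      have "restrict R F \<in> \<A>"
        using R P restrict by (force simp: \<A>_def)
      then have "restrict R F = P"
        using R by (intro min) auto
      with f show "R f = P f" by force
    qed
  qed
qed

text \<open>Together with subadditivity this makes a minimal functional additive. Minimality is
  tested against the functional \<open>R\<close> below, built from the fixed direction
  \<open>h\<close>.\<close>

lemma minimal_sublinear_on_superadditive:
  assumes P: "sublinear_on F P"
    and min: "\<forall>R. sublinear_on F R \<and> (\<forall>f\<in>F. R f \<le> P f) \<longrightarrow> (\<forall>f\<in>F. R f = P f)"
    and f: "f \<in> F" and h: "h \<in> F"
  shows "P f + P h \<le> P (\<lambda>x. f x + h x)"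
proof -
  define S where "S t f = P (\<lambda>x. f x + t * h x) - t * P h" for t f
  define R where "R f = (INF t\<in>{0..}. S t f)" for f
  have in_F: "(\<lambda>x. f x + t * h x) \<in> F" if "f \<in> F" for f t
    using that h function_subspaceD[OF F] by simp
  have scale: "P (\<lambda>x. t * h x) = t * P h" if "t \<ge> 0" for t
    using that sublinear_on_scale[OF P h, of t] sublinear_on_zero[OF P] by (cases "t = 0") auto
  \<comment> \<open>Since \<open>t * P h = P (t * h)\<close>, the bound comes from writing
    \<open>t * h\<close> as \<open>(f + t * h) - f\<close> and using subadditivity.\<close>
  have bdd: "bdd_below ((\<lambda>t. S t f) ` {0..})" if "f \<in> F" for f
  proof (rule bdd_belowI[of _ "- P (\<lambda>x. - f x)"], clarsimp)
    fix t :: real assume "t \<ge> 0"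
    have "P (\<lambda>x. (f x + t * h x) + - f x) \<le> P (\<lambda>x. f x + t * h x) + P (\<lambda>x. - f x)"
      by (rule sublinear_on_add[OF P in_F[OF that] function_subspace_minus[OF F that]])
    then show "- P (\<lambda>x. - f x) \<le> S t f"
      using scale[OF \<open>t \<ge> 0\<close>] by (simp add: S_def)
  qed
  have "sublinear_on F R"
    unfolding R_def
  proof (rule sublinear_on_INF)
    fix s t :: real and f g assume st: "s \<in> {0..}" "t \<in> {0..}" and fg: "f \<in> F" "g \<in> F"
    have "P (\<lambda>x. (f x + s * h x) + (g x + t * h x)) \<le> P (\<lambda>x. f x + s * h x) + P (\<lambda>x. g x + t * h x)"
      using fg by (intro sublinear_on_add[OF P] in_F)
    moreover have "(\<lambda>x. (f x + s * h x) + (g x + t * h x)) = (\<lambda>x. (f x + g x) + (s + t) * h x)"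
      by (auto simp: algebra_simps)
    ultimately have "S (s + t) (\<lambda>x. f x + g x) \<le> S s f + S t g"
      by (simp add: S_def algebra_simps)
    then show "\<exists>k\<in>{0..}. S k (\<lambda>x. f x + g x) \<le> S s f + S t g"
      using st by (intro bexI[of _ "s + t"]) auto
  next
    fix t c :: real and f assume t: "t \<in> {0..}" and c: "c > 0" and f: "f \<in> F"
    have "P (\<lambda>x. c * (f x + t * h x)) = c * P (\<lambda>x. f x + t * h x)"
      by (rule sublinear_on_scale[OF P in_F[OF f] c])
    then have "S (c * t) (\<lambda>x. c * f x) = c * S t f"
      by (simp add: S_def algebra_simps)
    then show "\<exists>k\<in>{0..}. S k (\<lambda>x. c * f x) \<le> c * S t f"
      using t c by (intro bexI[of _ "c * t"]) auto
  qed (use bdd in auto)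
  moreover have R_le: "R f \<le> S t f" if "f \<in> F" "t \<ge> 0" for f t
    unfolding R_def using bdd[OF that(1)] that(2) by (intro cINF_lower) auto
  \<comment> \<open>The parameter \<open>t = 0\<close> gives \<open>S 0 f = P f\<close>.\<close>
  then have "R f \<le> P f" if "f \<in> F" for f
    using R_le[OF that, of 0] by (simp add: S_def)
  ultimately have "R f = P f"
    using min f by blast
  then show ?thesis
    using R_le[OF f, of 1] by (simp add: S_def)
qed

text \<open>A form of the Hahn-Banach theorem. A minimal functional is additive, hence odd, and
  oddness extends its positive homogeneity to all real factors.\<close>

lemma dominated_linear_functional_exists:
  assumes "sublinear_on F Q"
  obtains m where "linear_functional_on F m" "\<And>f. f \<in> F \<Longrightarrow> m f \<le> Q f"
proof -
  obtain m where m: "sublinear_on F m" "\<And>f. f \<in> F \<Longrightarrow> m f \<le> Q f"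
    and min: "\<forall>R. sublinear_on F R \<and> (\<forall>f\<in>F. R f \<le> m f) \<longrightarrow> (\<forall>f\<in>F. R f = m f)"
    using minimal_sublinear_on_exists[OF assms] by blast
  have add: "m (\<lambda>x. f x + g x) = m f + m g" if "f \<in> F" "g \<in> F" for f g
    using minimal_sublinear_on_superadditive[OF m(1) min that] sublinear_on_add[OF m(1) that]
    by fastforce
  have minus: "m (\<lambda>x. - f x) = - m f" if "f \<in> F" for f
    using add[OF that function_subspace_minus[OF F that]] sublinear_on_zero[OF m(1)] by simp
  have "m (\<lambda>x. c * f x) = c * m f" if f: "f \<in> F" for c f
  proof (cases c "0 :: real" rule: linorder_cases)
    case less
    then show ?thesis
      using sublinear_on_scale[OF m(1) f, of "- c"] minus[OF function_subspace_scale[OF F f, of c]]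
      by simp
  next
    case equal
    then show ?thesis
      using sublinear_on_zero[OF m(1)] by simp
  next
    case greater
    then show ?thesis
      using sublinear_on_scale[OF m(1) f] by simp
  qed
  with add m(2) show thesis
    by (intro that[of m]) (auto simp: linear_functional_on_def)
qed

end

section \<open>Positive functionals on the continuous functions of a compact space\<close>

lemma function_subspace_continuous_map:
  "function_subspace {f. continuous_map T euclideanreal f}"
  by (auto simp: function_subspace_def intro: continuous_map_add continuous_map_real_mult_left
      intro!: exI[of _ "\<lambda>x. 0"])

text \<open>The upper bound \<open>m f \<le> b\<close> encodes three properties at once: applied to
  \<open>- f\<close> with \<open>b = 0\<close> it gives positivity, applied to the constant -1 it
  shows that \<open>m\<close> is nonzero, and applied to differences it gives Lipschitz continuity
  for the supremum metric.\<close>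

lemma positive_functional_vanishing_on_subspace:
  fixes T :: "'a topology"
  defines "F \<equiv> {f. continuous_map T euclideanreal f}"
  assumes compact: "compact_space T" and ne: "topspace T \<noteq> {}"
    and G: "function_subspace G" "G \<subseteq> F"
    and no_pos: "\<And>g. g \<in> G \<Longrightarrow> \<exists>x\<in>topspace T. g x \<le> 0"
  obtains m where "linear_functional_on F m"
    "\<And>f b. f \<in> F \<Longrightarrow> (\<And>x. x \<in> topspace T \<Longrightarrow> f x \<le> b) \<Longrightarrow> m f \<le> b"
    "\<And>g. g \<in> G \<Longrightarrow> m g = 0"
proof -
  define S where "S g f = (SUP x\<in>topspace T. f x + g x)" for g f :: "'a \<Rightarrow> real"
  define Q where "Q f = (INF g\<in>G. S g f)" for f
  have F: "function_subspace F"
    unfolding F_def by (rule function_subspace_continuous_map)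
  have bounded: "bounded (f ` topspace T)" if "f \<in> F" for f
    using that compact image_compactin[of T "topspace T" euclideanreal f]
    by (simp add: F_def compact_space_def compact_imp_bounded)
  have upper: "f x + g x \<le> S g f" if "f \<in> F" "g \<in> G" "x \<in> topspace T" for f g x
    unfolding S_def
    using that bounded_imp_bdd_above[OF bounded[OF function_subspace_add[OF F]]] G(2)
    by (intro cSUP_upper) auto
  have least: "S g f \<le> b" if "\<And>x. x \<in> topspace T \<Longrightarrow> f x + g x \<le> b" for f g b
    unfolding S_def using that by (intro cSUP_least ne) auto
  have bdd: "bdd_below ((\<lambda>g. S g f) ` G)" if f: "f \<in> F" for f
  proof -
    obtain B where B: "\<And>x. x \<in> topspace T \<Longrightarrow> \<bar>f x\<bar> \<le> B"
      using bounded[OF f] by (auto simp: bounded_iff)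
    \<comment> \<open>As \<open>- g\<close> also lies in \<open>G\<close>, it is nonpositive at some
      point. There \<open>g\<close> is nonnegative, and \<open>f + g\<close> is at least
      \<open>- B\<close>.\<close>
    have "- B \<le> S g f" if g: "g \<in> G" for g
    proof -
      obtain x where x: "x \<in> topspace T" "- g x \<le> 0"
        using no_pos[OF function_subspace_minus[OF G(1) g]] by auto
      then show ?thesis
        using upper[OF f g x(1)] B[OF x(1)] by simp
    qed
    then show ?thesis
      by (intro bdd_belowI[of _ "- B"]) auto
  qed
  have "sublinear_on F Q"
    unfolding Q_def
  proof (rule sublinear_on_INF[OF F])
    show "G \<noteq> {}"
      using G(1) by (simp add: function_subspace_def)
    fix g h f k assume gh: "g \<in> G" "h \<in> G" and fk: "f \<in> F" "k \<in> F"
    have "S (\<lambda>x. g x + h x) (\<lambda>x. f x + k x) \<le> S g f + S h k"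
      using upper[OF fk(1) gh(1)] upper[OF fk(2) gh(2)] by (intro least) fastforce
    then show "\<exists>l\<in>G. S l (\<lambda>x. f x + k x) \<le> S g f + S h k"
      using function_subspace_add[OF G(1) gh] by blast
  next
    fix g c f assume g: "g \<in> G" and c: "(c::real) > 0" and f: "f \<in> F"
    have "S (\<lambda>x. c * g x) (\<lambda>x. c * f x) \<le> c * S g f"
      using upper[OF f g] c by (intro least) (simp flip: distrib_left)
    then show "\<exists>l\<in>G. S l (\<lambda>x. c * f x) \<le> c * S g f"
      using function_subspace_scale[OF G(1) g] by blast
  qed (use bdd in auto)
  then obtain m where m: "linear_functional_on F m" "\<And>f. f \<in> F \<Longrightarrow> m f \<le> Q f"
    using dominated_linear_functional_exists[OF F] by blast
  \<comment> \<open>Each \<open>g\<close> in \<open>G\<close> certifies a bound on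
    \<open>m f\<close>: \<open>g = 0\<close> gives the bound by upper bounds of \<open>f\<close>,
    and for \<open>f\<close> in \<open>G\<close> the choice \<open>g = - f\<close> gives
    \<open>m f \<le> 0\<close>.\<close>
  have le: "m f \<le> b" if "f \<in> F" "g \<in> G" "\<And>x. x \<in> topspace T \<Longrightarrow> f x + g x \<le> b" for f g b
  proof -
    have "Q f \<le> S g f"
      unfolding Q_def using bdd[OF that(1)] that(2) by (rule cINF_lower)
    also have "\<dots> \<le> b"
      using that(3) by (rule least)
    finally show ?thesis
      using m(2)[OF that(1)] by simp
  qed
  have m_G: "m g \<le> 0" if "g \<in> G" for g
    using that G(2) function_subspace_minus[OF G(1) that] by (intro le[of g "\<lambda>x. - g x"]) auto
  show thesis
  proof
    show "m f \<le> b" if "f \<in> F" "\<And>x. x \<in> topspace T \<Longrightarrow> f x \<le> b" for f b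
      using that by (intro le[OF _ function_subspace_zero[OF G(1)]]) auto
    show "m g = 0" if g: "g \<in> G" for g
    proof -
      have "m (\<lambda>x. (-1) * g x) = (-1) * m g"
        using m(1) g G(2) unfolding linear_functional_on_def by blast
      then show ?thesis
        using m_G[OF g] m_G[OF function_subspace_minus[OF G(1) g]] by simp
    qed
  qed (rule m(1))
qed

section \<open>Stresses of a continuous tensegrity\<close>

context tensegrity
begin

lemma edge_subset:
  assumes "Inl e \<in> edges \<or> Inr e \<in> edges"
  obtains v1 v2 where "e = {v1, v2}" "v1 \<in> Vs" "v2 \<in> Vs"
proof -
  have "e \<subseteq> Vs" "card e = 2"
    using assms struts_edges cables_edges bars_edges by (auto simp: edges_def)
  then show thesis
    using that by (auto simp: card_2_iff)
qed

text \<open>The restriction to \<open>Vs\<close> does no harm because both end points of an edge lie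
  in \<open>Vs\<close>.\<close>

lemma rigidity_operator_add:
  assumes "a \<in> edges"
  shows "rigidity_operator (\<lambda>v\<in>Vs. V v + W v) a = rigidity_operator V a + rigidity_operator W a"
proof -
  have "length_change (\<lambda>v\<in>Vs. V v + W v) e = length_change V e + length_change W e"
    if e: "Inl e \<in> edges \<or> Inr e \<in> edges" for e
  proof -
    obtain v1 v2 where "e = {v1, v2}" "v1 \<in> Vs" "v2 \<in> Vs"
      by (rule edge_subset[OF e])
    then show ?thesis
      by (simp add: length_change_doubleton inner_add_left inner_diff_left)
  qed
  with assms show ?thesis
    by (auto simp: rigidity_operator_def split: sum.split)
qed

lemma rigidity_operator_scale:
  assumes "a \<in> edges"
  shows "rigidity_operator (\<lambda>v\<in>Vs. c *\<^sub>R V v) a = c * rigidity_operator V a"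
proof -
  have "length_change (\<lambda>v\<in>Vs. c *\<^sub>R V v) e = c * length_change V e"
    if e: "Inl e \<in> edges \<or> Inr e \<in> edges" for e
  proof -
    obtain v1 v2 where "e = {v1, v2}" "v1 \<in> Vs" "v2 \<in> Vs"
      by (rule edge_subset[OF e])
    then show ?thesis
      by (simp add: length_change_doubleton inner_diff_left right_diff_distrib)
  qed
  with assms show ?thesis
    by (auto simp: rigidity_operator_def split: sum.split)
qed

lemma restrict_in_edge_functions:
  "continuous_map edge_topology euclideanreal f \<Longrightarrow> restrict f edges \<in> edge_functions"
  by (auto simp: edge_functions_def elim: continuous_map_eq)

end

context continuous_tensegrity
begin

lemma rigidity_operator_X: "V \<in> X \<Longrightarrow> rigidity_operator V \<in> edge_functions"
  using subspace_X rigidity_operator_in_edge_functions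
  by (auto simp: linear_subspace_of_variations_def)

lemma strictly_positive_motion_excludes_semipositive_stress:
  assumes V: "strictly_positive_motion V"
  shows "\<not> semipositive_stress \<mu>"
proof
  assume \<mu>: "semipositive_stress \<mu>"
  let ?Y = "rigidity_operator V"
  have Y: "?Y \<in> edge_functions" and pos: "\<And>a. a \<in> edges \<Longrightarrow> ?Y a > 0"
    and V_X: "V \<in> X"
    using V by (auto simp: strictly_positive_motion_def rigidity_operator_X)
  have lin: "\<mu> (\<lambda>a\<in>edges. f a + g a) = \<mu> f + \<mu> g" "\<mu> (\<lambda>a\<in>edges. c * f a) = c * \<mu> f"
    if "f \<in> edge_functions" "g \<in> edge_functions" for f g c
    using \<mu> that by (auto simp: semipositive_stress_def stress_def edge_dual_def)
  have cont: "continuous_map edge_topology euclideanreal f" if "f \<in> edge_functions" for f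
    using that by (simp add: edge_functions_def)
  \<comment> \<open>The quotient \<open>- f / ?Y\<close> is continuous, hence bounded on the compact
    edgeset; this takes the place of an explicit positive lower bound for \<open>?Y\<close>.\<close>
  have ratio_bounded: "\<exists>B. \<forall>a\<in>edges. - f a \<le> B * ?Y a" if f: "f \<in> edge_functions" for f
  proof -
    have "continuous_map edge_topology euclideanreal (\<lambda>a. - f a / ?Y a)"
      using pos by (intro continuous_map_real_divide continuous_map_minus cont f Y) force
    then have "bounded ((\<lambda>a. - f a / ?Y a) ` edges)"
      using image_compactin[of edge_topology edges] compact_edges
      by (fastforce simp: compact_space_def intro: compact_imp_bounded)
    then obtain B where "\<And>a. a \<in> edges \<Longrightarrow> - f a / ?Y a \<le> B"
      unfolding bounded_iff by (fastforce simp: abs_le_iff)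
    then have "- f a \<le> B * ?Y a" if "a \<in> edges" for a
      using pos[OF that] that by (metis pos_divide_le_eq)
    then show ?thesis by blast
  qed
  \<comment> \<open>Adding a multiple of \<open>?Y\<close> makes \<open>f\<close> nonnegative
    without changing its value under \<open>\<mu>\<close>, since a stress vanishes at
    \<open>?Y\<close>. So \<open>\<mu>\<close> is nonnegative on all edge functions, and the case of
    \<open>- f\<close> then forces \<open>\<mu> f = 0\<close>.\<close>
  have nonneg: "0 \<le> \<mu> f" if f: "f \<in> edge_functions" for f
  proof -
    obtain B where B: "\<And>a. a \<in> edges \<Longrightarrow> - f a \<le> B * ?Y a"
      using ratio_bounded[OF f] by blast
    let ?BY = "\<lambda>a\<in>edges. B * ?Y a"
    have BY: "?BY \<in> edge_functions"
      by (intro restrict_in_edge_functions continuous_map_real_mult_left cont Y)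
    have "(\<lambda>a\<in>edges. f a + ?BY a) \<in> edge_functions"
      by (intro restrict_in_edge_functions continuous_map_add cont f BY)
    then have "(\<lambda>a\<in>edges. f a + ?BY a) \<in> nonneg_edge_functions"
      using B by (fastforce simp: nonneg_edge_functions_def)
    then have "0 \<le> \<mu> (\<lambda>a\<in>edges. f a + ?BY a)"
      using \<mu> by (simp only: semipositive_stress_def)
    also have "\<dots> = \<mu> f + B * \<mu> ?Y"
      by (simp only: lin(1)[OF f BY] lin(2)[OF Y Y])
    also have "\<mu> ?Y = 0"
      using \<mu> V_X by (auto simp: semipositive_stress_def stress_def)
    finally show ?thesis by simp
  qed
  have "\<mu> f = 0" if f: "f \<in> edge_functions" for f
  proof -
    have "(\<lambda>a\<in>edges. (-1) * f a) \<in> edge_functions"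
      by (intro restrict_in_edge_functions continuous_map_real_mult_left cont f)
    then show ?thesis
      using nonneg[OF f] nonneg lin(2)[OF f f, of "-1"] by fastforce
  qed
  then show False
    using \<mu> by (auto simp: semipositive_stress_def)
qed

lemma semipositive_stress_exists:
  assumes "partially_bar_equivalent"
  obtains \<mu> where "semipositive_stress \<mu>"
proof -
  define F where "F = {f. continuous_map edge_topology euclideanreal f}"
  \<comment> \<open>Values off \<open>edges\<close> are left free, so that \<open>G\<close> is
    closed under the unrestricted pointwise operations.\<close>
  define G where "G = {f. \<exists>V\<in>X. \<forall>a\<in>edges. f a = rigidity_operator V a}"
  have X: "(\<lambda>v\<in>Vs. 0) \<in> X" "\<And>V W. V \<in> X \<Longrightarrow> W \<in> X \<Longrightarrow> (\<lambda>v\<in>Vs. V v + W v) \<in> X"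
    "\<And>c V. V \<in> X \<Longrightarrow> (\<lambda>v\<in>Vs. c *\<^sub>R V v) \<in> X"
    using subspace_X unfolding linear_subspace_of_variations_def by blast+
  have no_pos: "\<exists>a\<in>edges. rigidity_operator V a \<le> 0" if "V \<in> X" for V
    using assms that by (force simp: partially_bar_equivalent_def strictly_positive_motion_def)
  \<comment> \<open>On an empty edgeset the zero variation would be a strictly positive motion
    vacuously.\<close>
  have ne: "edges \<noteq> {}"
    using no_pos[OF X(1)] by blast
  have F: "function_subspace F"
    unfolding F_def by (rule function_subspace_continuous_map)
  have G: "function_subspace G"
    unfolding function_subspace_def
  proof (intro conjI ballI allI)
    show "G \<noteq> {}"
      using X(1) by (auto simp: G_def)
    show "(\<lambda>a. f a + g a) \<in> G" if fg: "f \<in> G" "g \<in> G" for f g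
    proof -
      obtain V W where "V \<in> X" "W \<in> X" "\<forall>a\<in>edges. f a = rigidity_operator V a"
        "\<forall>a\<in>edges. g a = rigidity_operator W a"
        using fg unfolding G_def by blast
      then show ?thesis
        unfolding G_def by (auto intro!: bexI[OF _ X(2)] simp: rigidity_operator_add)
    qed
    show "(\<lambda>a. c * f a) \<in> G" if f: "f \<in> G" for c f
    proof -
      obtain V where "V \<in> X" "\<forall>a\<in>edges. f a = rigidity_operator V a"
        using f unfolding G_def by blast
      then show ?thesis
        unfolding G_def by (auto intro!: bexI[OF _ X(3)] simp: rigidity_operator_scale)
    qed
  qed
  have GF: "G \<subseteq> F"
  proof
    fix f assume "f \<in> G"
    then obtain V where V: "V \<in> X" "\<And>a. a \<in> edges \<Longrightarrow> f a = rigidity_operator V a"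
      by (auto simp: G_def)
    have "continuous_map edge_topology euclideanreal (rigidity_operator V)"
      using rigidity_operator_X[OF V(1)] by (simp add: edge_functions_def)
    then show "f \<in> F"
      unfolding F_def using V(2) by (auto intro: continuous_map_eq)
  qed
  have "\<exists>a\<in>topspace edge_topology. g a \<le> 0" if "g \<in> G" for g
    using that no_pos by (fastforce simp: G_def)
  from positive_functional_vanishing_on_subspace[OF compact_edges _ G GF[unfolded F_def] this]
  obtain m where m: "linear_functional_on F m"
      "\<And>f b. f \<in> F \<Longrightarrow> (\<And>a. a \<in> edges \<Longrightarrow> f a \<le> b) \<Longrightarrow> m f \<le> b"
      "\<And>g. g \<in> G \<Longrightarrow> m g = 0"
    using ne unfolding F_def topspace_edge_topology by blast
  have m_add: "m (\<lambda>a. f a + g a) = m f + m g" and m_scale: "m (\<lambda>a. c * f a) = c * m f"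
    if "f \<in> F" "g \<in> F" for f g c
    using m(1) that by (auto simp: linear_functional_on_def)
  have diff_in_F: "(\<lambda>a. f a + (-1) * g a) \<in> F" if "f \<in> F" "g \<in> F" for f g
    using function_subspace_add[OF F] function_subspace_scale[OF F] that by blast
  have m_diff: "m f - m g \<le> b" if "f \<in> F" "g \<in> F" "\<And>a. a \<in> edges \<Longrightarrow> f a - g a \<le> b" for f g b
  proof -
    have "m (\<lambda>a. f a + (-1) * g a) = m f + (-1) * m g"
      using that by (simp only: m_add function_subspace_scale[OF F] m_scale)
    then show ?thesis
      using m(2)[OF diff_in_F[OF that(1,2)], of b] that(3) by simp
  qed
  \<comment> \<open>The bound with \<open>b = 0\<close> in both directions shows that
    \<open>m\<close> sees only the values on \<open>edges\<close>. This allows the passage from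
    total functions to extensional ones.\<close>
  have m_cong: "m f = m g" if "f \<in> F" "g \<in> F" "\<And>a. a \<in> edges \<Longrightarrow> f a = g a" for f g
    using m_diff[of f g 0] m_diff[of g f 0] that by simp
  have EF: "f \<in> F" if "f \<in> edge_functions" for f
    using that by (simp add: F_def edge_functions_def)
  have FE: "restrict f edges \<in> edge_functions" if "f \<in> F" for f
    using that by (simp add: F_def restrict_in_edge_functions)
  have m_restrict: "m (restrict f edges) = m f" if "f \<in> F" for f
    using that FE EF by (intro m_cong) auto
  define \<mu> where "\<mu> = restrict m edge_functions"
  let ?M = "cfunspace edge_topology (euclidean_metric :: real metric)"
  \<comment> \<open>The constant is 1: \<open>m f - m g\<close> is at most any upper bound of
    \<open>f - g\<close>, in particular the supremum distance, and likewise with \<open>f\<close>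
    and \<open>g\<close> exchanged.\<close>
  have "Lipschitz_continuous_map ?M euclidean_metric \<mu>"
    unfolding Lipschitz_continuous_map_def mspace_cfunspace_edge_topology
  proof (intro conjI exI[of _ 1] ballI)
    fix f g assume fg: "f \<in> edge_functions" "g \<in> edge_functions"
    have "dist (f a) (g a) \<le> mdist ?M f g" if "a \<in> edges" for a
      using mdist_cfunspace_imp_mdist_le[of f edge_topology "euclidean_metric :: real metric" g "mdist ?M f g" a] fg that
      unfolding mspace_cfunspace_edge_topology by simp
    then have "f a - g a \<le> mdist ?M f g" "g a - f a \<le> mdist ?M f g" if "a \<in> edges" for a
      using that by (fastforce simp: dist_real_def abs_le_iff)+
    then have "\<bar>m f - m g\<bar> \<le> mdist ?M f g"
      using m_diff[of f g] m_diff[of g f] EF fg by (simp add: abs_le_iff)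
    then show "mdist euclidean_metric (\<mu> f) (\<mu> g) \<le> 1 * mdist ?M f g"
      using fg by (simp add: \<mu>_def dist_real_def)
  qed auto
  then have "continuous_map (mtopology_of ?M) euclideanreal \<mu>"
    using Lipschitz_continuous_imp_continuous_map by force
  then have "\<mu> \<in> edge_dual"
    using EF FE m_add m_scale m_restrict function_subspaceD[OF F] by (simp add: edge_dual_def \<mu>_def)
  moreover have "\<mu> (rigidity_operator V) = 0" if "V \<in> X" for V
    using that m(3)[of "rigidity_operator V"] rigidity_operator_X by (auto simp: \<mu>_def G_def)
  ultimately have "stress \<mu>"
    by (simp add: stress_def)
  \<comment> \<open>The constant -1 is mapped to a value of at most -1, so \<open>\<mu>\<close> does
    not vanish there.\<close>
  moreover have "\<exists>f\<in>edge_functions. \<mu> f \<noteq> 0"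
  proof -
    have "(\<lambda>a. -1) \<in> F"
      by (simp add: F_def)
    then have "m (restrict (\<lambda>a. -1) edges) \<le> -1"
      using m(2)[of "\<lambda>a. -1" "-1"] m_restrict by simp
    then show ?thesis
      using FE[OF \<open>(\<lambda>a. -1) \<in> F\<close>] by (intro bexI[of _ "restrict (\<lambda>a. -1) edges"]) (auto simp: \<mu>_def)
  qed
  moreover have "0 \<le> \<mu> f" if "f \<in> nonneg_edge_functions" for f
  proof -
    have "f \<in> edge_functions" "\<And>a. a \<in> edges \<Longrightarrow> 0 \<le> f a"
      using that by (auto simp: nonneg_edge_functions_def)
    then show ?thesis
      using m(2)[OF function_subspace_minus[OF F], of f 0] m_scale[of f f "-1"] EF
      by (simp add: \<mu>_def)
  qed
  ultimately show thesis
    by (intro that[of \<mu>]) (simp add: semipositive_stress_def)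
qed

end

theorem theorem3p5p2:
  fixes Vs :: "'v set" and p :: "'v \<Rightarrow> real ^ 'n"
    and struts cables bars :: "'v set set"
    and X :: "('v \<Rightarrow> real ^ 'n) set"
  assumes "continuous_tensegrity Vs p struts cables bars X"
  shows "continuous_tensegrity.partially_bar_equivalent p struts cables bars X \<longleftrightarrow>
    (\<exists>\<mu>. continuous_tensegrity.semipositive_stress p struts cables bars X \<mu>)"
proof -
  interpret continuous_tensegrity Vs p struts cables bars X
    by (fact assms)
  show ?thesis
    using strictly_positive_motion_excludes_semipositive_stress semipositive_stress_exists
    unfolding partially_bar_equivalent_def by metis
qed

end
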